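(* Let $p\in(1,\infty)$ and let $\mathsf G=(\mathsf V,m,b,c)$ be a connected finite graph with $m\equiv1$, $c\equiv0$ and minimal cut weight $\eta_{\mathsf G}$. Let $\emptyset\neq\mathsf V_0\subset\mathsf V$ be such that $\mathsf V\setminus\mathsf V_0$ consists of $n-1$ vertices, where $n\ge2$. Then $$\lambda_{0,p}(\mathsf G;\mathsf V_0)\ \ge\ \eta_{\mathsf G}\left(\frac1{\sum_{k=1}^{n-1}(n-k)^{\frac1{p-1}}}\right)^{p-1}.$$
   Context: A finite graph $\mathsf G=(\mathsf V,m,b,c)$ consists of a finite set $\mathsf V$, $m:\mathsf V\to(0,\infty)$, a symmetric $b:\mathsf V\times\mathsf V\to[0,\infty)$ with $b(\mathsf v,\mathsf v)=0$, and $c:\mathsf V\to[0,\infty)$. Connected: any two vertices are joined by a sequence of vertices whose consecutive members have $b>0$. Minimal cut weight: $\eta_{\mathsf G}=\min\sum_{\mathsf v\in\mathsf V_1,\mathsf w\in\mathsf V_2}b(\mathsf v,\mathsf w)$, minimum over all partitions $\mathsf V=\mathsf V_1\sqcup\mathsf V_2$ into two nonempty sets. Smallest eigenvalue of the $p$-Laplacian with Dirichlet conditions at $\mathsf V_0$ (for $c\equiv0$): $$\lambda_{0,p}(\mathsf G;\mathsf V_0)=\inf_{0\ne f:\mathsf V\to\mathbb R,\ f|_{\mathsf V_0}=0}\frac{\frac12\sum_{\mathsf v,\mathsf w}b(\mathsf v,\mathsf w)|f(\mathsf v)-f(\mathsf w)|^p}{\sum_{\mathsf v\in\mathsf V\setminus\mathsf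 V_0}|f(\mathsf v)|^pm(\mathsf v)}.$$ *)

theory Defs
  imports "HOL-Analysis.Analysis"
begin

locale finite_graph =
  fixes V :: "'v set"
    and m :: "'v \<Rightarrow> real"
    and b :: "'v \<Rightarrow> 'v \<Rightarrow> real"
    and c :: "'v \<Rightarrow> real"
  assumes finite_V: "finite V"
    and m_pos: "v \<in> V \<Longrightarrow> 0 < m v"
    and b_nonneg: "v \<in> V \<Longrightarrow> w \<in> V \<Longrightarrow> 0 \<le> b v w"
    and b_sym: "v \<in> V \<Longrightarrow> w \<in> V \<Longrightarrow> b v w = b w v"
    and b_diag: "v \<in> V \<Longrightarrow> b v v = 0"
    and c_nonneg: "v \<in> V \<Longrightarrow> 0 \<le> c v"

locale connected_finite_graph = finite_graph V m b c
  for V :: "'v set" and m b c +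
  assumes connected_V:
    "v \<in> V \<Longrightarrow> w \<in> V \<Longrightarrow> (v, w) \<in> {(x, y). x \<in> V \<and> y \<in> V \<and> 0 < b x y}\<^sup>*"

(* For finite V the minimum is taken over a finite set, nonempty as soon as card V >= 2. *)
definition min_cut_weight :: "'v set \<Rightarrow> ('v \<Rightarrow> 'v \<Rightarrow> real) \<Rightarrow> real" where
  "min_cut_weight V b =
     Min {(\<Sum>v\<in>V1. \<Sum>w\<in>V2. b v w) | V1 V2.
            V1 \<noteq> {} \<and> V2 \<noteq> {} \<and> V1 \<inter> V2 = {} \<and> V1 \<union> V2 = V}"

definition rayleigh_quotient_p ::
  "'v set \<Rightarrow> ('v \<Rightarrow> real) \<Rightarrow> ('v \<Rightarrow> 'v \<Rightarrow> real) \<Rightarrow> 'v set \<Rightarrow> real \<Rightarrow> ('v \<Rightarrow> real) \<Rightarrow> real" where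
  "rayleigh_quotient_p V m b V0 p f =
     (1 / 2 * (\<Sum>v\<in>V. \<Sum>w\<in>V. b v w * \<bar>f v - f w\<bar> powr p)) /
     (\<Sum>v\<in>V - V0. \<bar>f v\<bar> powr p * m v)"

(* This is the eigenvalue for vanishing killing term c.  Functions on V are represented by total
   functions whose values off V are irrelevant, so f \<noteq> 0 means that f does not vanish identically
   on V. *)
definition lambda_0_p ::
  "'v set \<Rightarrow> ('v \<Rightarrow> real) \<Rightarrow> ('v \<Rightarrow> 'v \<Rightarrow> real) \<Rightarrow> 'v set \<Rightarrow> real \<Rightarrow> real" where
  "lambda_0_p V m b V0 p =
     Inf {rayleigh_quotient_p V m b V0 p f | f. (\<exists>v\<in>V. f v \<noteq> 0) \<and> (\<forall>v\<in>V0. f v = 0)}"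

end

theory Submission
  imports Defs
begin

text \<open>
  Replacing \<open>f\<close> by \<open>\<bar>f\<bar>\<close>, sort its values on \<open>V - V0\<close> as
  \<open>0 = a\<^sub>0 \<le> a\<^sub>1 \<le> \<dots> \<le> a\<^bsub>n-1\<^esub>\<close>, with increments \<open>d\<^sub>j = a\<^sub>j - a\<^bsub>j-1\<^esub>\<close>.
  Superadditivity of \<open>t powr p\<close> bounds the energy below by the sum over \<open>j\<close> of \<open>d\<^sub>j powr p\<close>
  times the weight of the cut that separates the vertices of rank at least \<open>j\<close> from the others,
  hence by \<open>\<eta> * (\<Sum>j. d\<^sub>j powr p)\<close>.
  Hoelder's inequality with weights \<open>g\<^sub>j = (n - j) powr (1 / (p - 1))\<close> bounds \<open>a\<^sub>k powr p\<close> by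
  \<open>(\<Sum>j. g\<^sub>j) powr (p - 1) * (\<Sum>j\<le>k. d\<^sub>j powr p / (n - j))\<close>. Summing over \<open>k\<close> counts the index
  \<open>j\<close> exactly \<open>n - j\<close> times, which cancels the weight.
\<close>

section \<open>Convexity inequalities for real powers\<close>

lemma sum_powr_le_powr_sum:
  fixes x :: "'a \<Rightarrow> real"
  assumes "finite A" "\<And>i. i \<in> A \<Longrightarrow> 0 \<le> x i" "1 \<le> p"
  shows "(\<Sum>i\<in>A. x i powr p) \<le> (\<Sum>i\<in>A. x i) powr p"
proof -
  have split: "t powr p = t * t powr (p - 1)" if "0 \<le> t" for t :: real
    using that powr_mult_base[of t "p - 1"] by simp
  have "(\<Sum>i\<in>A. x i powr p) = (\<Sum>i\<in>A. x i * x i powr (p - 1))"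
    using assms(2) split by (intro sum.cong) auto
  also have "\<dots> \<le> (\<Sum>i\<in>A. x i * (\<Sum>i\<in>A. x i) powr (p - 1))"
    using assms by (intro sum_mono mult_left_mono powr_mono2 member_le_sum) auto
  also have "\<dots> = (\<Sum>i\<in>A. x i) powr p"
    using split[of "\<Sum>i\<in>A. x i"] assms(2) by (simp add: sum_distrib_right sum_nonneg)
  finally show ?thesis .
qed

text \<open>This is the tangent line of the convex function \<open>t powr p\<close> at
  \<open>A\<close>. Young's inequality for \<open>t\<close> and \<open>A powr (p - 1)\<close>, with
  exponents \<open>p\<close> and \<open>p / (p - 1)\<close>, gives it without derivatives and
  includes the boundary case \<open>A = 0\<close>.\<close>

lemma powr_ge_tangent:
  fixes t A p :: real
  assumes "1 < p" "0 \<le> t" "0 \<le> A"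
  shows "A powr p + p * A powr (p - 1) * (t - A) \<le> t powr p"
proof -
  have base: "A powr (p - 1) * A = A powr p"
    using assms(3) powr_mult_base[of A "p - 1"] by (simp add: mult.commute)
  have "t * A powr (p - 1) \<le> t powr p / p + (A powr (p - 1)) powr (p / (p - 1)) / (p / (p - 1))"
    using assms by (intro Youngs_inequality) (auto simp: field_simps)
  also have "\<dots> = (t powr p + (p - 1) * A powr p) / p"
  proof -
    have "(A powr (p - 1)) powr (p / (p - 1)) = A powr p"
      using assms(1) by (simp add: powr_powr)
    then show ?thesis using assms(1) by (simp add: field_simps)
  qed
  finally have "p * (t * A powr (p - 1)) \<le> t powr p + (p - 1) * A powr p"
    using assms(1) by (simp add: field_simps)
  then show ?thesis
    using base by (simp add: algebra_simps)
qed

text \<open>Jensen's inequality for \<open>t powr p\<close> at the points \<open>d j / g j\<close>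
  with weights \<open>g j\<close>; equivalently, Hoelder's inequality.\<close>

lemma powr_sum_le_weighted:
  fixes d g :: "'a \<Rightarrow> real"
  assumes "finite J" "1 < p" "\<And>j. j \<in> J \<Longrightarrow> 0 \<le> d j" "\<And>j. j \<in> J \<Longrightarrow> 0 < g j"
  shows "(\<Sum>j\<in>J. d j) powr p \<le> (\<Sum>j\<in>J. g j) powr (p - 1) * (\<Sum>j\<in>J. g j powr (1 - p) * d j powr p)"
proof (cases "J = {}")
  case False
  define S where "S = (\<Sum>j\<in>J. d j)"
  define U where "U = (\<Sum>j\<in>J. g j)"
  have U: "0 < U"
    unfolding U_def using assms False by (intro sum_pos) auto
  have S: "0 \<le> S"
    unfolding S_def using assms by (intro sum_nonneg) auto
  have term_eq: "g j * (d j / g j) powr p = g j powr (1 - p) * d j powr p" if "j \<in> J" for j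
    using assms(3,4)[OF that] by (simp add: powr_divide powr_diff)
  \<comment> \<open>The tangent is taken at the weighted mean \<open>S / U\<close> of the points
    \<open>d j / g j\<close>. Weighted by \<open>g j\<close>, the linear terms then sum to
    zero.\<close>
  have "U * (S / U) powr p = (\<Sum>j\<in>J. g j * ((S / U) powr p + p * (S / U) powr (p - 1) * (d j / g j - S / U)))"
  proof -
    have "(\<Sum>j\<in>J. g j * ((S / U) powr p + p * (S / U) powr (p - 1) * (d j / g j - S / U)))
        = (\<Sum>j\<in>J. g j * (S / U) powr p + p * (S / U) powr (p - 1) * (d j - g j * (S / U)))"
    proof (intro sum.cong refl)
      fix j assume "j \<in> J"
      then have "g j \<noteq> 0" using assms(4) by force
      then show "g j * ((S / U) powr p + p * (S / U) powr (p - 1) * (d j / g j - S / U))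
          = g j * (S / U) powr p + p * (S / U) powr (p - 1) * (d j - g j * (S / U))"
        by (simp add: algebra_simps)
    qed
    also have "\<dots> = U * (S / U) powr p + p * (S / U) powr (p - 1) * (S - U * (S / U))"
      unfolding S_def U_def
      by (simp only: sum.distrib sum_subtractf sum_distrib_left[symmetric] sum_distrib_right[symmetric])
    finally show ?thesis using U by simp
  qed
  also have "\<dots> \<le> (\<Sum>j\<in>J. g j * (d j / g j) powr p)"
    using assms S U by (intro sum_mono mult_left_mono powr_ge_tangent) (auto simp: less_imp_le)
  also have "\<dots> = (\<Sum>j\<in>J. g j powr (1 - p) * d j powr p)"
    using term_eq by (intro sum.cong) auto
  finally have le: "U * (S / U) powr p \<le> (\<Sum>j\<in>J. g j powr (1 - p) * d j powr p)" .
  have "S powr p = U powr (p - 1) * (U * (S / U) powr p)"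
    using S U by (simp add: powr_divide powr_diff)
  also have "\<dots> \<le> U powr (p - 1) * (\<Sum>j\<in>J. g j powr (1 - p) * d j powr p)"
    using le by (intro mult_left_mono) auto
  finally show ?thesis
    unfolding S_def U_def .
qed simp

section \<open>A Hardy-type inequality for partial sums\<close>

lemma discrete_hardy_bound:
  fixes d :: "nat \<Rightarrow> real"
  assumes "1 < p" "\<And>j. 0 \<le> d j"
  shows "(\<Sum>k=1..n-1. (\<Sum>j=1..k. d j) powr p)
    \<le> (\<Sum>k=1..n-1. real (n - k) powr (1 / (p - 1))) powr (p - 1) * (\<Sum>j=1..n-1. d j powr p)"
proof -
  define g where "g j = real (n - j) powr (1 / (p - 1))" for j
  define U where "U = (\<Sum>j=1..n-1. g j)"
  have g_pos: "0 < g j" and g_powr: "g j powr (1 - p) = 1 / real (n - j)" if "j \<in> {1..n-1}" for j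
  proof -
    have pos: "0 < real (n - j)" using that by auto
    then show "0 < g j" by (simp add: g_def)
    have "1 / (p - 1) * (1 - p) = -1" using assms(1) by (simp add: field_simps)
    then show "g j powr (1 - p) = 1 / real (n - j)"
      unfolding g_def powr_powr using pos by (simp add: powr_minus_divide)
  qed
  \<comment> \<open>The range of \<open>j\<close> is written as a condition on
    \<open>{1..n-1}\<close> so that \<open>sum.swap_restrict\<close> can exchange the two sums
    later.\<close>
  have "(\<Sum>j=1..k. d j) powr p \<le> U powr (p - 1) * (\<Sum>j | j \<in> {1..n-1} \<and> j \<le> k. d j powr p / real (n - j))"
    if k: "k \<in> {1..n-1}" for k
  proof -
    have set_eq: "{j. j \<in> {1..n-1} \<and> j \<le> k} = {1..k}" using k by auto
    have "(\<Sum>j=1..k. d j) powr p \<le> (\<Sum>j=1..k. g j) powr (p - 1) * (\<Sum>j=1..k. g j powr (1 - p) * d j powr p)"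
      using assms g_pos k by (intro powr_sum_le_weighted) auto
    \<comment> \<open>Only the sum of the \<open>g j\<close> is extended to all indices, which makes
      the constant independent of \<open>k\<close>. The other sum stays cut off at \<open>k\<close>,
      as the later count of the pairs \<open>j \<le> k\<close> requires.\<close>
    also have "\<dots> \<le> U powr (p - 1) * (\<Sum>j=1..k. g j powr (1 - p) * d j powr p)"
      unfolding U_def using assms k g_pos
      by (intro mult_right_mono powr_mono2 sum_mono2 sum_nonneg) (auto intro!: less_imp_le[OF g_pos])
    also have "(\<Sum>j=1..k. g j powr (1 - p) * d j powr p) = (\<Sum>j=1..k. d j powr p / real (n - j))"
      using k g_powr by (intro sum.cong) auto
    finally show ?thesis unfolding set_eq .
  qed
  then have "(\<Sum>k=1..n-1. (\<Sum>j=1..k. d j) powr p)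
      \<le> (\<Sum>k=1..n-1. U powr (p - 1) * (\<Sum>j | j \<in> {1..n-1} \<and> j \<le> k. d j powr p / real (n - j)))"
    by (rule sum_mono)
  also have "\<dots> = U powr (p - 1) * (\<Sum>j=1..n-1. \<Sum>k | k \<in> {1..n-1} \<and> j \<le> k. d j powr p / real (n - j))"
    unfolding sum_distrib_left[symmetric] by (subst sum.swap_restrict) auto
  also have "(\<Sum>j=1..n-1. \<Sum>k | k \<in> {1..n-1} \<and> j \<le> k. d j powr p / real (n - j)) = (\<Sum>j=1..n-1. d j powr p)"
  proof (intro sum.cong refl)
    fix j assume j: "j \<in> {1..n-1}"
    then have "{k. k \<in> {1..n-1} \<and> j \<le> k} = {j..n-1}" by auto
    then show "(\<Sum>k | k \<in> {1..n-1} \<and> j \<le> k. d j powr p / real (n - j)) = d j powr p"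
      using j by (auto simp: Suc_diff_le)
  qed
  finally show ?thesis
    unfolding U_def g_def .
qed

section \<open>Increments of monotone sequences\<close>

lemma sum_increments_between:
  fixes a :: "nat \<Rightarrow> real"
  assumes "i \<le> k"
  shows "(\<Sum>j\<in>{i<..k}. a j - a (j - 1)) = a k - a i"
  using assms
proof (induction k rule: dec_induct)
  case (step k)
  then have "{i<..Suc k} = insert (Suc k) {i<..k}" by auto
  then show ?case using step.IH by simp
qed simp

text \<open>The thresholds \<open>j\<close> that separate \<open>i\<close> from \<open>k\<close>
  form the half-open interval between them. The increments there telescope to the difference of the
  values, so superadditivity of the power applies.\<close>

lemma sum_powr_increments_le:
  fixes a :: "nat \<Rightarrow> real"
  assumes "1 \<le> p" "mono a" "i \<le> N" "k \<le> N"
  shows "(\<Sum>j=1..N. if (j \<le> i) \<noteq> (j \<le> k) then (a j - a (j - 1)) powr p else 0) \<le> \<bar>a i - a k\<bar> powr p"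
  using assms(3,4)
proof (induction i k rule: linorder_wlog)
  case (le i k)
  have inc: "0 \<le> a j - a (j - 1)" for j
    using monoD[OF assms(2), of "j - 1" j] by simp
  have "{j \<in> {1..N}. (j \<le> i) \<noteq> (j \<le> k)} = {i<..k}"
    using le by auto
  then have "(\<Sum>j=1..N. if (j \<le> i) \<noteq> (j \<le> k) then (a j - a (j - 1)) powr p else 0)
      = (\<Sum>j\<in>{i<..k}. (a j - a (j - 1)) powr p)"
    by (simp flip: sum.inter_filter)
  also have "\<dots> \<le> (\<Sum>j\<in>{i<..k}. a j - a (j - 1)) powr p"
    using inc assms(1) by (intro sum_powr_le_powr_sum) auto
  also have "\<dots> = \<bar>a i - a k\<bar> powr p"
    using monoD[OF assms(2) le(1)] sum_increments_between[OF le(1), of a] by simp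
  finally show ?case .
next
  case (sym i k)
  have "((j \<le> i) \<noteq> (j \<le> k)) = ((j \<le> k) \<noteq> (j \<le> i))" for j
    by blast
  then show ?case
    using sym by (simp only: abs_minus_commute[of "a i"])
qed

section \<open>Cuts and energy\<close>

context finite_graph
begin

lemma finite_cut_weights:
  "finite {(\<Sum>v\<in>V1. \<Sum>w\<in>V2. b v w) | V1 V2. V1 \<noteq> {} \<and> V2 \<noteq> {} \<and> V1 \<inter> V2 = {} \<and> V1 \<union> V2 = V}"
proof (rule finite_subset)
  show "finite ((\<lambda>(V1, V2). \<Sum>v\<in>V1. \<Sum>w\<in>V2. b v w) ` (Pow V \<times> Pow V))"
    using finite_V by simp
qed force

lemma min_cut_weight_le:
  assumes "S \<subseteq> V" "S \<noteq> {}" "S \<noteq> V"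
  shows "min_cut_weight V b \<le> (\<Sum>v\<in>S. \<Sum>w\<in>V - S. b v w)"
  unfolding min_cut_weight_def
  by (rule Min_le[OF finite_cut_weights]) (use assms in blast)

text \<open>The set \<open>S\<close> provides one admissible partition, so that \<open>Min\<close>
  is taken over a nonempty set and is attained by a sum of nonnegative weights.\<close>

lemma min_cut_weight_nonneg:
  assumes "S \<subseteq> V" "S \<noteq> {}" "S \<noteq> V"
  shows "0 \<le> min_cut_weight V b"
proof -
  let ?C = "{(\<Sum>v\<in>V1. \<Sum>w\<in>V2. b v w) | V1 V2. V1 \<noteq> {} \<and> V2 \<noteq> {} \<and> V1 \<inter> V2 = {} \<and> V1 \<union> V2 = V}"
  have "(\<Sum>v\<in>S. \<Sum>w\<in>V - S. b v w) \<in> ?C"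
    using assms by blast
  then have "Min ?C \<in> ?C"
    using finite_cut_weights by (intro Min_in) auto
  then show ?thesis
    unfolding min_cut_weight_def by (auto intro!: sum_nonneg b_nonneg)
qed

text \<open>Each crossing edge is met in both orientations, with equal weight by symmetry of
  \<open>b\<close>. This matches the factor 1/2 in the energy.\<close>

lemma double_cut_weight:
  assumes "S \<subseteq> V"
  shows "(\<Sum>v\<in>V. \<Sum>w\<in>V. if (v \<in> S) \<noteq> (w \<in> S) then b v w else 0) = 2 * (\<Sum>v\<in>S. \<Sum>w\<in>V - S. b v w)"
proof -
  have fin: "finite S" "finite (V - S)"
    using finite_V assms finite_subset by auto
  have in_S: "(\<Sum>w\<in>V. if (v \<in> S) \<noteq> (w \<in> S) then b v w else 0) = (\<Sum>w\<in>V - S. b v w)" if "v \<in> S" for v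
    using that finite_V by (intro sum.mono_neutral_cong_right) auto
  have out_S: "(\<Sum>w\<in>V. if (v \<in> S) \<noteq> (w \<in> S) then b v w else 0) = (\<Sum>w\<in>S. b v w)" if "v \<notin> S" for v
    using that assms finite_V by (intro sum.mono_neutral_cong_right) auto
  have "(\<Sum>v\<in>V. \<Sum>w\<in>V. if (v \<in> S) \<noteq> (w \<in> S) then b v w else 0)
      = (\<Sum>v\<in>V - S. \<Sum>w\<in>S. b v w) + (\<Sum>v\<in>S. \<Sum>w\<in>V - S. b v w)"
    using sum.subset_diff[OF assms finite_V, of "\<lambda>v. \<Sum>w\<in>V. if (v \<in> S) \<noteq> (w \<in> S) then b v w else 0"]
      in_S out_S by simp
  also have "(\<Sum>v\<in>V - S. \<Sum>w\<in>S. b v w) = (\<Sum>w\<in>S. \<Sum>v\<in>V - S. b w v)"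
    by (subst sum.swap) (use assms b_sym in \<open>intro sum.cong, auto\<close>)
  finally show ?thesis by simp
qed

text \<open>A discrete coarea argument: the energy is compared with cuts at the levels of a rank
  function \<open>r\<close>, which assigns to \<open>v\<close> the value
  \<open>a (r v)\<close>.\<close>

lemma energy_ge_min_cut_weight:
  fixes a :: "nat \<Rightarrow> real" and r :: "'v \<Rightarrow> nat"
  assumes "1 \<le> p" "mono a" "\<And>v. v \<in> V \<Longrightarrow> r v \<le> N" "{..N} \<subseteq> r ` V"
  shows "min_cut_weight V b * (\<Sum>j=1..N. (a j - a (j - 1)) powr p)
    \<le> 1 / 2 * (\<Sum>v\<in>V. \<Sum>w\<in>V. b v w * \<bar>a (r v) - a (r w)\<bar> powr p)"
proof -
  define D where "D j = (a j - a (j - 1)) powr p" for j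
  \<comment> \<open>Superlevel sets of the rank, not of the value, remain nonempty and proper when
    values of \<open>a\<close> coincide; a tied level has \<open>D j = 0\<close>.\<close>
  define S where "S j = {v \<in> V. j \<le> r v}" for j
  have cut: "min_cut_weight V b \<le> (\<Sum>v\<in>S j. \<Sum>w\<in>V - S j. b v w)" if "j \<in> {1..N}" for j
  proof (rule min_cut_weight_le)
    have "j \<in> r ` V" "0 \<in> r ` V" using that assms(4) by auto
    then obtain u v where "u \<in> V" "r u = j" "v \<in> V" "r v = 0" by auto
    then have "u \<in> S j" "v \<in> V - S j" using that by (auto simp: S_def)
    then show "S j \<noteq> {}" "S j \<noteq> V" by auto
  qed (auto simp: S_def)
  have "min_cut_weight V b * (\<Sum>j=1..N. D j) \<le> (\<Sum>j=1..N. D j * (\<Sum>v\<in>S j. \<Sum>w\<in>V - S j. b v w))"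
    using cut by (subst mult.commute, unfold sum_distrib_right)
      (intro sum_mono mult_left_mono, auto simp: D_def)
  also have "\<dots> = (\<Sum>j=1..N. D j * (1 / 2 * (\<Sum>v\<in>V. \<Sum>w\<in>V. if (v \<in> S j) \<noteq> (w \<in> S j) then b v w else 0)))"
    by (subst double_cut_weight) (auto simp: S_def)
  also have "\<dots> = 1 / 2 * (\<Sum>j=1..N. \<Sum>v\<in>V. \<Sum>w\<in>V. b v w * (if (v \<in> S j) \<noteq> (w \<in> S j) then D j else 0))"
    unfolding sum_distrib_left by (intro sum.cong) auto
  also have "(\<Sum>j=1..N. \<Sum>v\<in>V. \<Sum>w\<in>V. b v w * (if (v \<in> S j) \<noteq> (w \<in> S j) then D j else 0))
      = (\<Sum>v\<in>V. \<Sum>j=1..N. \<Sum>w\<in>V. b v w * (if (v \<in> S j) \<noteq> (w \<in> S j) then D j else 0))"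
    by (rule sum.swap)
  also have "\<dots> = (\<Sum>v\<in>V. \<Sum>w\<in>V. \<Sum>j=1..N. b v w * (if (v \<in> S j) \<noteq> (w \<in> S j) then D j else 0))"
    by (intro sum.cong refl sum.swap)
  also have "\<dots> = (\<Sum>v\<in>V. \<Sum>w\<in>V. b v w * (\<Sum>j=1..N. if (j \<le> r v) \<noteq> (j \<le> r w) then D j else 0))"
    unfolding sum_distrib_left by (intro sum.cong refl) (auto simp: S_def)
  also have "1 / 2 * \<dots> \<le> 1 / 2 * (\<Sum>v\<in>V. \<Sum>w\<in>V. b v w * \<bar>a (r v) - a (r w)\<bar> powr p)"
    unfolding D_def using assms
    by (intro mult_left_mono sum_mono sum_powr_increments_le b_nonneg) auto
  finally show ?thesis unfolding D_def by simp
qed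

end

section \<open>Ranking the vertices and bounding the eigenvalue\<close>

lemma finite_set_sorted_enumeration:
  fixes f :: "'a \<Rightarrow> 'b::linorder"
  assumes "finite A"
  obtains h where "bij_betw h {1..card A} A" "mono_on {1..card A} (f \<circ> h)"
proof -
  obtain xs where xs: "set xs = A" "distinct xs"
    using finite_distinct_list[OF assms] by blast
  define ys where "ys = sort_key f xs"
  have ys: "set ys = A" "distinct ys" "length ys = card A" "sorted (map f ys)"
    using xs distinct_card[of xs] by (auto simp: ys_def)
  \<comment> \<open>The shift from list positions to \<open>{1..card A}\<close> leaves index 0 free
    for the Dirichlet vertices.\<close>
  have "bij_betw (\<lambda>i. i - 1) {1..card A} {..<card A}"
    by (rule bij_betw_byWitness[where f' = Suc]) auto
  moreover have "bij_betw (\<lambda>i. ys ! i) {..<card A} A"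
    using ys bij_betw_nth by metis
  ultimately have "bij_betw ((\<lambda>i. ys ! i) \<circ> (\<lambda>i. i - 1)) {1..card A} A"
    by (rule bij_betw_trans)
  moreover have "mono_on {1..card A} (f \<circ> ((\<lambda>i. ys ! i) \<circ> (\<lambda>i. i - 1)))"
  proof (rule mono_onI)
    fix i k assume "i \<in> {1..card A}" "k \<in> {1..card A}" "i \<le> k"
    then show "(f \<circ> ((\<lambda>i. ys ! i) \<circ> (\<lambda>i. i - 1))) i \<le> (f \<circ> ((\<lambda>i. ys ! i) \<circ> (\<lambda>i. i - 1))) k"
      using sorted_nth_mono[OF ys(4), of "i - 1" "k - 1"] ys(3) by auto
  qed
  ultimately show ?thesis by (rule that)
qed

lemma (in finite_graph) dirichlet_energy_bound:
  fixes f :: "'v \<Rightarrow> real"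
  assumes "1 < p" "V0 \<noteq> {}" "V0 \<subseteq> V" "2 \<le> n" "card (V - V0) = n - 1" "\<forall>v\<in>V0. f v = 0"
  shows "min_cut_weight V b * (\<Sum>v\<in>V - V0. \<bar>f v\<bar> powr p)
    \<le> (\<Sum>k=1..n-1. real (n - k) powr (1 / (p - 1))) powr (p - 1) *
      (1 / 2 * (\<Sum>v\<in>V. \<Sum>w\<in>V. b v w * \<bar>f v - f w\<bar> powr p))"
proof -
  let ?N = "n - 1" and ?\<eta> = "min_cut_weight V b"
  let ?C = "(\<Sum>k=1..n-1. real (n - k) powr (1 / (p - 1))) powr (p - 1)"
  obtain h where h: "bij_betw h {1..?N} (V - V0)" "mono_on {1..?N} ((\<lambda>v. \<bar>f v\<bar>) \<circ> h)"
    using finite_set_sorted_enumeration[of "V - V0" "\<lambda>v. \<bar>f v\<bar>"] finite_V assms(5) by auto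
  \<comment> \<open>The value at 0 is the Dirichlet value, and \<open>min\<close> freezes the
    sequence after index \<open>n - 1\<close>, so that \<open>a\<close> is monotone on all natural
    numbers.\<close>
  define a where "a i = (if i = 0 then 0 else \<bar>f (h (min i ?N))\<bar>)" for i
  \<comment> \<open>All of \<open>V0\<close> shares rank 0, while a vertex outside \<open>V0\<close>
    has positive rank even if \<open>f\<close> vanishes there.\<close>
  define r where "r v = (if v \<in> V0 then 0 else the_inv_into {1..?N} h v)" for v
  have inv: "the_inv_into {1..?N} h v \<in> {1..?N}" "h (the_inv_into {1..?N} h v) = v" if "v \<in> V - V0" for v
    using that h(1) the_inv_into_into[of h "{1..?N}" v "{1..?N}"] f_the_inv_into_f[of h "{1..?N}" v]
    unfolding bij_betw_def by blast+
  have r_le: "r v \<le> ?N" if "v \<in> V" for v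
    using inv(1)[of v] that by (auto simp: r_def)
  have a_r: "a (r v) = \<bar>f v\<bar>" if "v \<in> V" for v
    using inv[of v] that assms(6) by (auto simp: r_def a_def min_absorb1)
  have r_surj: "{..?N} \<subseteq> r ` V"
  proof
    fix i assume i: "i \<in> {..?N}"
    show "i \<in> r ` V"
    proof (cases "i = 0")
      case True
      then show ?thesis using assms(2,3) by (auto simp: r_def image_iff)
    next
      case False
      then have "i \<in> {1..?N}" using i by auto
      then have "h i \<in> V - V0" "r (h i) = i"
        using h(1) by (auto simp: r_def bij_betw_def the_inv_into_f_f)
      then show ?thesis by (metis DiffD1 image_eqI)
    qed
  qed
  have a_mono: "mono a"
  proof
    fix i k :: nat assume "i \<le> k"
    then show "a i \<le> a k"
      using mono_onD[OF h(2), of "min i ?N" "min k ?N"] assms(4) by (auto simp: a_def)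
  qed
  define E where "E = (\<Sum>j=1..?N. (a j - a (j - 1)) powr p)"
  have eta_nonneg: "0 \<le> ?\<eta>"
    by (rule min_cut_weight_nonneg[of V0]) (use assms in auto)
  have "(\<Sum>v\<in>V - V0. \<bar>f v\<bar> powr p) = (\<Sum>k=1..?N. \<bar>f (h k)\<bar> powr p)"
    using sum.reindex_bij_betw[OF h(1), of "\<lambda>v. \<bar>f v\<bar> powr p"] by simp
  also have "\<dots> = (\<Sum>k=1..?N. (\<Sum>j=1..k. a j - a (j - 1)) powr p)"
  proof (intro sum.cong refl)
    fix k assume k: "k \<in> {1..?N}"
    have "{1..k} = {0<..k}" by auto
    then show "\<bar>f (h k)\<bar> powr p = (\<Sum>j=1..k. a j - a (j - 1)) powr p"
      using k sum_increments_between[of 0 k a] by (simp add: a_def min_absorb1)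
  qed
  also have "\<dots> \<le> ?C * E"
    unfolding E_def using assms(1) a_mono by (intro discrete_hardy_bound) (auto simp: monoD)
  finally have "?\<eta> * (\<Sum>v\<in>V - V0. \<bar>f v\<bar> powr p) \<le> ?C * (?\<eta> * E)"
    using mult_left_mono[OF _ eta_nonneg] by (metis mult.left_commute)
  also have "?\<eta> * E \<le> 1 / 2 * (\<Sum>v\<in>V. \<Sum>w\<in>V. b v w * \<bar>a (r v) - a (r w)\<bar> powr p)"
    unfolding E_def using assms(1) a_mono r_le r_surj by (intro energy_ge_min_cut_weight) auto
  \<comment> \<open>By the reverse triangle inequality, passing from \<open>f\<close> to its
    absolute value does not increase the energy.\<close>
  also have "\<dots> \<le> 1 / 2 * (\<Sum>v\<in>V. \<Sum>w\<in>V. b v w * \<bar>f v - f w\<bar> powr p)"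
    using assms(1) by (intro mult_left_mono sum_mono powr_mono2 b_nonneg) (auto simp: a_r)
  finally show ?thesis
    by (simp add: mult_left_mono)
qed

theorem corollary5p15:
  fixes V V0 :: "'v set"
    and m c :: "'v \<Rightarrow> real"
    and b :: "'v \<Rightarrow> 'v \<Rightarrow> real"
    and p :: real
    and n :: nat
  assumes "1 < p"
    and "connected_finite_graph V m b c"
    and "\<forall>v\<in>V. m v = 1"
    and "\<forall>v\<in>V. c v = 0"
    and "V0 \<noteq> {}"
    and "V0 \<subseteq> V"
    and "n \<ge> 2"
    and "card (V - V0) = n - 1"
  shows "lambda_0_p V m b V0 p \<ge>
    min_cut_weight V b * (1 / (\<Sum>k=1..n-1. real (n - k) powr (1 / (p - 1)))) powr (p - 1)"
proof -
  interpret connected_finite_graph V m b c by fact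
  define U where "U = (\<Sum>k=1..n-1. real (n - k) powr (1 / (p - 1)))"
  have U: "0 < U"
    unfolding U_def using assms(7) by (intro sum_pos) auto
  show ?thesis
    unfolding lambda_0_p_def U_def[symmetric]
  proof (rule cInf_greatest)
    \<comment> \<open>The indicator of \<open>V - V0\<close> is an admissible function, so the
      infimum is over a nonempty set.\<close>
    have "V - V0 \<noteq> {}"
      using assms(7,8) by (intro notI) simp
    then obtain u where "u \<in> V - V0" by blast
    then have "(\<exists>v\<in>V. indicator (V - V0) v \<noteq> (0::real)) \<and> (\<forall>v\<in>V0. indicator (V - V0) v = (0::real))"
      by (auto simp: indicator_def)
    then show "{rayleigh_quotient_p V m b V0 p f |f. (\<exists>v\<in>V. f v \<noteq> 0) \<and> (\<forall>v\<in>V0. f v = 0)} \<noteq> {}"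
      by blast
  next
    fix x assume "x \<in> {rayleigh_quotient_p V m b V0 p f |f. (\<exists>v\<in>V. f v \<noteq> 0) \<and> (\<forall>v\<in>V0. f v = 0)}"
    then obtain f u where x: "x = rayleigh_quotient_p V m b V0 p f"
      and f: "\<forall>v\<in>V0. f v = 0" and u: "u \<in> V" "f u \<noteq> 0"
      by blast
    define D where "D = (\<Sum>v\<in>V - V0. \<bar>f v\<bar> powr p)"
    define E where "E = 1 / 2 * (\<Sum>v\<in>V. \<Sum>w\<in>V. b v w * \<bar>f v - f w\<bar> powr p)"
    \<comment> \<open>A point where \<open>f\<close> is nonzero lies outside \<open>V0\<close>, so
      the denominator of the quotient is positive.\<close>
    have "u \<in> V - V0" using f u by auto
    then have D: "0 < D"
      unfolding D_def using u finite_V by (intro sum_pos2[of _ u]) auto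
    have "(\<Sum>v\<in>V - V0. \<bar>f v\<bar> powr p * m v) = D"
      unfolding D_def using assms(3) by (intro sum.cong) auto
    then have "x = E / D"
      by (simp add: x rayleigh_quotient_p_def E_def)
    moreover have "min_cut_weight V b * D \<le> U powr (p - 1) * E"
      unfolding D_def E_def U_def by (rule dirichlet_energy_bound) (use assms f in auto)
    then have "min_cut_weight V b / U powr (p - 1) \<le> E / D"
      using D U by (simp add: field_simps)
    ultimately show "min_cut_weight V b * (1 / U) powr (p - 1) \<le> x"
      using U by (simp add: powr_divide)
  qed
qed

end
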